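(* Let $\mathbb{K}$ be a field, $\lambda\in\mathbb{K}$, $\ell\ge1$, let $k_1,\dots,k_\ell$ and $r_1>\cdots>r_\ell$ be positive integers, and let $J_\lambda=\bigoplus_{i=1}^\ell k_iJ_{\lambda,r_i}$. Let $I_\lambda\subseteq R$ be the ideal generated by the $2\times2$ minors of $(J_\lambda\boldsymbol{x}\mid\boldsymbol{x})$, and for $j\in\{1,\dots,\ell\}$ let $\mathfrak{q}_{\lambda,j}=I_\lambda+I_j$ with $I_j$ as in the context. Then, for each $j\in\{1,\dots,\ell\}$, the ideal $\mathfrak{q}_{\lambda,j}$ is primary. In particular, the decomposition $I_\lambda=\bigcap_{j=1}^\ell\mathfrak{q}_{\lambda,j}$ is a primary decomposition of $I_\lambda$.
   Context: $J_{\lambda,r}$ denotes the $r\times r$ Jordan block with $\lambda$ on the diagonal and $1$ on the superdiagonal; $kJ_{\lambda,r}$ is the direct sum (block diagonal matrix) of $k$ copies of $J_{\lambda,r}$. The rows of $J_\lambda$ are indexed by $\Lambda=\{(i_1,i_2,i_3): 1\le i_1\le\ell,\ 1\le i_2\le k_{i_1},\ 1\le i_3\le r_{i_1}\}$ in lexicographically increasing order: $(i_1,i_2,i_3)$ is the $i_3$-th row of the $i_2$-th copy of $J_{\lambda,r_{i_1}}$. $R=\mathbb{K}[x(\boldsymbol{i}):\boldsymbol{i}\in\Lambda]$, and $\boldsymbol{x}$ is the column vector of the variables in this order. $(J_\lambda\boldsymbol{x}\mid\boldsymbol{x})$ is the two-column matrix with columns $J_\lambda\boldsymbol{x}$ and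 $\boldsymbol{x}$. For $j\in\{1,\dots,\ell\}$: $\Lambda_{j,1}=\{(i_1,i_2,i_3)\in\Lambda: i_1\le j,\ r_j+1\le i_3\le r_{i_1}\}$, $\Lambda_{j,2}=\{(i_1,i_2,i_3)\in\Lambda: i_1>j\}$, and $I_j=\langle x(\boldsymbol{i}):\boldsymbol{i}\in\Lambda_{j,1}\cup\Lambda_{j,2}\rangle$ (the zero ideal if the index set is empty). *)

theory Defs
  imports
    "HOL-Library.Poly_Mapping"
    "HOL-Algebra.Ideal"
    "Jordan_Normal_Form.Jordan_Normal_Form"
    "Jordan_Normal_Form.DL_Submatrix"
begin

subsection \<open>Multivariate polynomials and polynomial rings\<close>

text \<open>A polynomial is a finitely supported map from monomials to coefficients, a monomial a
  finitely supported map from variables to exponents; multiplication is the convolution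
  product of \<^theory>\<open>HOL-Library.Poly_Mapping\<close>.\<close>

type_synonym ('v, 'a) mvpoly = "('v \<Rightarrow>\<^sub>0 nat) \<Rightarrow>\<^sub>0 'a"

definition Const :: "'a::zero \<Rightarrow> ('v, 'a) mvpoly"
  where "Const c = Poly_Mapping.single 0 c"

definition Var :: "'v \<Rightarrow> ('v, 'a::zero_neq_one) mvpoly"
  where "Var v = Poly_Mapping.single (Poly_Mapping.single v 1) 1"

definition vars :: "('v, 'a::zero) mvpoly \<Rightarrow> 'v set"
  where "vars p = (\<Union>m\<in>Poly_Mapping.keys p. Poly_Mapping.keys m)"

definition poly_ring :: "'v set \<Rightarrow> ('v, 'a::comm_ring_1) mvpoly ring"
  where "poly_ring V =
    \<lparr>carrier = {p. vars p \<subseteq> V}, monoid.mult = (*), one = 1, zero = 0, add = (+)\<rparr>"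

lemma poly_ring_simps [simp]:
  "p \<in> carrier (poly_ring V) \<longleftrightarrow> vars p \<subseteq> V"
  "p \<otimes>\<^bsub>poly_ring V\<^esub> q = p * q" "\<one>\<^bsub>poly_ring V\<^esub> = 1"
  "p \<oplus>\<^bsub>poly_ring V\<^esub> q = p + q" "\<zero>\<^bsub>poly_ring V\<^esub> = 0"
  by (simp_all add: poly_ring_def)

lemma vars_simps [simp]:
  "vars 0 = {}" "vars (1 :: ('v, 'a::zero_neq_one) mvpoly) = {}"
  by (simp_all add: vars_def)

lemma vars_add: "vars (p + q) \<subseteq> vars p \<union> vars q"
  using Poly_Mapping.keys_add[of p q] unfolding vars_def by blast

lemma vars_uminus [simp]: "vars (- p) = vars (p :: ('v, 'a::comm_ring_1) mvpoly)"
  by (simp add: vars_def)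

lemma vars_mult: "vars (p * q) \<subseteq> vars p \<union> vars (q :: ('v, 'a::comm_ring_1) mvpoly)"
proof
  fix v assume "v \<in> vars (p * q)"
  then obtain m where m: "m \<in> Poly_Mapping.keys (p * q)" "v \<in> Poly_Mapping.keys m"
    by (auto simp: vars_def)
  obtain a b where ab: "a \<in> Poly_Mapping.keys p" "b \<in> Poly_Mapping.keys q" "m = a + b"
    using m(1) Poly_Mapping.keys_mult[of p q] by blast
  have "v \<in> Poly_Mapping.keys a \<union> Poly_Mapping.keys b"
    using m(2) ab(3) Poly_Mapping.keys_add[of a b] by blast
  then show "v \<in> vars p \<union> vars q" using ab by (auto simp: vars_def)
qed

lemma cring_poly_ring: "cring (poly_ring V :: ('v, 'a::comm_ring_1) mvpoly ring)"
proof (rule cringI)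
  show "abelian_group (poly_ring V :: ('v, 'a) mvpoly ring)"
  proof (rule abelian_groupI)
    fix p :: "('v, 'a) mvpoly"
    assume "p \<in> carrier (poly_ring V)"
    then show "\<exists>q\<in>carrier (poly_ring V). q \<oplus>\<^bsub>poly_ring V\<^esub> p = \<zero>\<^bsub>poly_ring V\<^esub>"
      by (intro bexI[of _ "- p"]) auto
  qed (use vars_add in \<open>fastforce simp: ac_simps\<close>)+
  show "Group.comm_monoid (poly_ring V :: ('v, 'a) mvpoly ring)"
    by (rule comm_monoidI) (use vars_mult in \<open>fastforce simp: ac_simps\<close>)+
qed (simp add: algebra_simps)

subsection \<open>Primary ideals and primary decompositions\<close>

definition primary_ideal :: "'a set \<Rightarrow> ('a, 'b) ring_scheme \<Rightarrow> bool"
  where "primary_ideal Q R \<longleftrightarrow>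
    ideal Q R \<and> Q \<noteq> carrier R \<and>
    (\<forall>a\<in>carrier R. \<forall>b\<in>carrier R. a \<otimes>\<^bsub>R\<^esub> b \<in> Q \<longrightarrow>
      a \<in> Q \<or> (\<exists>n::nat. n \<ge> 1 \<and> b [^]\<^bsub>R\<^esub> n \<in> Q))"

definition primary_decomposition ::
    "('a, 'b) ring_scheme \<Rightarrow> 'a set \<Rightarrow> 'i set \<Rightarrow> ('i \<Rightarrow> 'a set) \<Rightarrow> bool"
  where "primary_decomposition R I A Q \<longleftrightarrow>
    finite A \<and> A \<noteq> {} \<and> (\<forall>j\<in>A. primary_ideal (Q j) R) \<and> I = (\<Inter>j\<in>A. Q j)"

subsection \<open>Minors\<close>

definition minors :: "nat \<Rightarrow> 'a::comm_ring_1 mat \<Rightarrow> 'a set"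
  where "minors t M =
    {det (submatrix M S T) | S T.
      S \<subseteq> {..<dim_row M} \<and> T \<subseteq> {..<dim_col M} \<and> card S = t \<and> card T = t}"

subsection \<open>The matrix and its ideals\<close>

text \<open>Below, \<open>l\<close> is the number of distinct block sizes, and \<open>k i\<close> is the number of Jordan
  blocks of size \<open>r i\<close>, for \<open>1 \<le> i \<le> l\<close>.\<close>

type_synonym index = "nat \<times> nat \<times> nat"

definition Lambda :: "nat \<Rightarrow> (nat \<Rightarrow> nat) \<Rightarrow> (nat \<Rightarrow> nat) \<Rightarrow> index set"
  where "Lambda l k r = {(i1, i2, i3). i1 \<in> {1..l} \<and> i2 \<in> {1..k i1} \<and> i3 \<in> {1..r i1}}"

definition Lambda_list :: "nat \<Rightarrow> (nat \<Rightarrow> nat) \<Rightarrow> (nat \<Rightarrow> nat) \<Rightarrow> index list"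
  where "Lambda_list l k r =
    [(i1, i2, i3). i1 \<leftarrow> [1..<Suc l], i2 \<leftarrow> [1..<Suc (k i1)], i3 \<leftarrow> [1..<Suc (r i1)]]"

lemma set_Lambda_list: "set (Lambda_list l k r) = Lambda l k r"
  by (force simp: Lambda_list_def Lambda_def simp del: upt_Suc)

lemma sorted_Lambda_list:
  "sorted_wrt (\<lambda>i i'. (i, i') \<in> less_than <*lex*> less_than <*lex*> less_than) (Lambda_list l k r)"
proof -
  have *: "sorted_wrt P (concat (map f xs))"
    if "sorted_wrt (<) xs" "\<And>x. x \<in> set xs \<Longrightarrow> sorted_wrt P (f x)"
      "\<And>x y a b. x < y \<Longrightarrow> a \<in> set (f x) \<Longrightarrow> b \<in> set (f y) \<Longrightarrow> P a b"
    for P and f :: "nat \<Rightarrow> index list" and xs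
    using that(1,2) by (induction xs) (auto simp: sorted_wrt_append intro: that(3))
  have **: "sorted_wrt (<) [a..<b]" for a b :: nat by simp
  show ?thesis
    unfolding Lambda_list_def
    by (intro *) (auto simp: sorted_wrt_map simp del: upt_Suc intro!: **)
qed

definition jordan_J :: "nat \<Rightarrow> (nat \<Rightarrow> nat) \<Rightarrow> (nat \<Rightarrow> nat) \<Rightarrow> 'a::{zero,one} \<Rightarrow> 'a mat"
  where "jordan_J l k r c =
    jordan_matrix (concat (map (\<lambda>i. replicate (k i) (r i, c)) [1..<Suc l]))"

definition x_vec :: "nat \<Rightarrow> (nat \<Rightarrow> nat) \<Rightarrow> (nat \<Rightarrow> nat) \<Rightarrow> (index, 'a::zero_neq_one) mvpoly vec"
  where "x_vec l k r = vec_of_list (map Var (Lambda_list l k r))"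

lemma dim_jordan_J_x_vec:
  "dim_row (jordan_J l k r c) = dim_vec (x_vec l k r)"
  "dim_col (jordan_J l k r c) = dim_vec (x_vec l k r)"
proof -
  have "sum_list (concat xss) = sum_list (map sum_list xss)" for xss :: "nat list list"
    by (induction xss) auto
  then show "dim_row (jordan_J l k r c) = dim_vec (x_vec l k r)"
    and "dim_col (jordan_J l k r c) = dim_vec (x_vec l k r)"
    by (simp_all add: jordan_J_def x_vec_def Lambda_list_def length_concat map_concat
        sum_list_replicate comp_def sum_list_triv del: upt_Suc)
qed

definition Jx_x :: "nat \<Rightarrow> (nat \<Rightarrow> nat) \<Rightarrow> (nat \<Rightarrow> nat) \<Rightarrow> 'a::field \<Rightarrow> (index, 'a) mvpoly mat"
  where "Jx_x l k r c =
    mat_of_cols (dim_vec (x_vec l k r :: (index, 'a) mvpoly vec))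
      [map_mat Const (jordan_J l k r c) *\<^sub>v x_vec l k r, x_vec l k r]"

definition I_lam :: "nat \<Rightarrow> (nat \<Rightarrow> nat) \<Rightarrow> (nat \<Rightarrow> nat) \<Rightarrow> 'a::field \<Rightarrow> (index, 'a) mvpoly set"
  where "I_lam l k r c = genideal (poly_ring (Lambda l k r)) (minors 2 (Jx_x l k r c))"

definition Lambda1 :: "nat \<Rightarrow> (nat \<Rightarrow> nat) \<Rightarrow> (nat \<Rightarrow> nat) \<Rightarrow> nat \<Rightarrow> index set"
  where "Lambda1 l k r j =
    {(i1, i2, i3) \<in> Lambda l k r. i1 \<le> j \<and> r j + 1 \<le> i3 \<and> i3 \<le> r i1}"

definition Lambda2 :: "nat \<Rightarrow> (nat \<Rightarrow> nat) \<Rightarrow> (nat \<Rightarrow> nat) \<Rightarrow> nat \<Rightarrow> index set"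
  where "Lambda2 l k r j = {(i1, i2, i3) \<in> Lambda l k r. i1 > j}"

definition I_var :: "nat \<Rightarrow> (nat \<Rightarrow> nat) \<Rightarrow> (nat \<Rightarrow> nat) \<Rightarrow> nat \<Rightarrow> (index, 'a::field) mvpoly set"
  where "I_var l k r j =
    genideal (poly_ring (Lambda l k r)) (Var ` (Lambda1 l k r j \<union> Lambda2 l k r j))"

definition q_ideal ::
    "nat \<Rightarrow> (nat \<Rightarrow> nat) \<Rightarrow> (nat \<Rightarrow> nat) \<Rightarrow> 'a::field \<Rightarrow> nat \<Rightarrow> (index, 'a) mvpoly set"
  where "q_ideal l k r c j = I_lam l k r c <+>\<^bsub>poly_ring (Lambda l k r)\<^esub> I_var l k r j"

end

theory Submission
  imports Defs "HOL-Library.Product_Lexorder"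
begin

text \<open>Give the variable \<open>x(i1,i2,i3)\<close> the multidegree of its block \<open>(i1,i2)\<close> and the weight
  \<open>i3 - 1\<close>. The eigenvalue cancels from the minors, so modulo \<open>I_\<lambda>\<close> weight can be moved freely between
  the factors of a monomial, and the monomial becomes zero once a factor leaves its block.
  Hence the class of a monomial depends only on its multidegree and its total weight, and it is zero
  if the weight is at least \<open>r_j\<close>, where \<open>j\<close> is the largest \<open>i1\<close> that occurs.

  Map \<open>x(i1,i2,i3)\<close> to \<open>a(i1,i2) t^(i3-1)\<close> if \<open>i1 \<le> j\<close> and to \<open>0\<close> otherwise. By the above,
  \<open>q_(\<lambda>,j)\<close> is the preimage of the ideal generated by \<open>t^(r_j)\<close>, which is primary because the
  coefficients of \<open>t\<close> lie in a domain. A polynomial in all these preimages has vanishing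
  coefficient sum on every class that is not already zero modulo \<open>I_\<lambda>\<close>, so it lies in \<open>I_\<lambda>\<close>.\<close>

section \<open>Ideals of polynomial rings\<close>

lemma ideal_sum_closed:
  assumes "ideal Q (poly_ring V)" "\<And>i. i \<in> A \<Longrightarrow> f i \<in> Q"
  shows "sum f A \<in> Q"
proof -
  have Q: "additive_subgroup Q (poly_ring V)" by (rule ideal.axioms(1)[OF assms(1)])
  have "0 \<in> Q" using additive_subgroup.zero_closed[OF Q] by simp
  moreover have "a + b \<in> Q" if "a \<in> Q" "b \<in> Q" for a b
    using additive_subgroup.a_closed[OF Q that] by simp
  ultimately show ?thesis using assms(2) by (induction A rule: infinite_finite_induct) auto
qed

lemma ideal_mult_closed:
  assumes "ideal Q (poly_ring V)" "vars p \<subseteq> V" "q \<in> Q"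
  shows "p * q \<in> Q"
  using ideal.I_l_closed[OF assms(1,3), of p] assms(2) by simp

lemma ideal_uminus_closed:
  assumes "ideal Q (poly_ring V)" "q \<in> Q"
  shows "- q \<in> Q"
  using ideal_mult_closed[OF assms(1) _ assms(2), of "-1"] by simp

lemma ideal_add_closed:
  assumes "ideal Q (poly_ring V)" "p \<in> Q" "q \<in> Q"
  shows "p + q \<in> Q"
  using additive_subgroup.a_closed[OF ideal.axioms(1)[OF assms(1)] assms(2,3)] by simp

lemma ideal_diff_closed:
  assumes "ideal Q (poly_ring V)" "p \<in> Q" "q \<in> Q"
  shows "p - q \<in> Q"
  using ideal_add_closed[OF assms(1,2) ideal_uminus_closed[OF assms(1,3)]] by simp

lemma ideal_zero_closed:
  assumes "ideal Q (poly_ring V)"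
  shows "0 \<in> Q"
  using ideal_sum_closed[OF assms, of "{}"] by simp

lemma pow_poly_ring: "p [^]\<^bsub>poly_ring V\<^esub> (n::nat) = p ^ n"
proof -
  interpret cring "poly_ring V" by (rule cring_poly_ring)
  show ?thesis by (induction n) (simp_all add: mult.commute)
qed

section \<open>Monomials and coefficients\<close>

lemma vars_Const [simp]: "vars (Const c) = {}"
  by (auto simp: vars_def Const_def split: if_splits)

lemma vars_Var [simp]: "vars (Var v :: ('v, 'a::zero_neq_one) mvpoly) = {v}"
  by (auto simp: vars_def Var_def)

lemma keys_nat_add:
  "Poly_Mapping.keys (m + m' :: 'v \<Rightarrow>\<^sub>0 nat) = Poly_Mapping.keys m \<union> Poly_Mapping.keys m'"
  by (auto simp: in_keys_iff lookup_add)

definition Monom :: "('v \<Rightarrow>\<^sub>0 nat) \<Rightarrow> ('v, 'a::zero_neq_one) mvpoly"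
  where "Monom m = Poly_Mapping.single m 1"

lemma vars_Monom [simp]: "vars (Monom m :: ('v, 'a::zero_neq_one) mvpoly) = Poly_Mapping.keys m"
  by (simp add: vars_def Monom_def)

lemma Monom_add: "Monom (m + m') = (Monom m * Monom m' :: ('v, 'a::comm_ring_1) mvpoly)"
  by (simp add: Monom_def mult_single)

lemma Monom_single: "Monom (Poly_Mapping.single v 1) = Var v"
  by (simp add: Monom_def Var_def)

lemma single_eq_Const_mult: "Poly_Mapping.single m c = Const c * (Monom m :: ('v, 'a::comm_ring_1) mvpoly)"
  by (simp add: Const_def Monom_def mult_single)

lemma Const_add: "Const (a + b) = Const a + (Const b :: ('v, 'a::comm_ring_1) mvpoly)"
  by (simp add: Const_def single_add)

lemma Const_0 [simp]: "Const 0 = 0"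
  by (simp add: Const_def)

lemma Const_1 [simp]: "Const 1 = 1"
  by (simp add: Const_def)

lemma Const_mult: "Const (a * b) = Const a * (Const b :: ('v, 'a::comm_ring_1) mvpoly)"
  by (simp add: Const_def mult_single)

lemma Const_sum: "Const (sum f A) = (\<Sum>i\<in>A. Const (f i) :: ('v, 'a::comm_ring_1) mvpoly)"
  by (induction A rule: infinite_finite_induct) (simp_all add: Const_add)

lemma poly_mapping_eq_sum_single:
  "p = (\<Sum>m\<in>Poly_Mapping.keys p. Poly_Mapping.single m (Poly_Mapping.lookup p m))"
  by (rule poly_mapping_eqI) (auto simp: lookup_sum lookup_single when_def in_keys_iff)

text \<open>Modulo \<open>Q\<close> each monomial may be replaced by a representative of its class,
  which turns \<open>f\<close> into the sum over all classes of coefficient sum times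
  representative. Each term lies in \<open>Q\<close>: the representative does if \<open>B\<close>
  holds, and otherwise the coefficient sum is zero.\<close>

lemma mem_ideal_if_class_sums_zero:
  fixes f :: "('v, 'a::comm_ring_1) mvpoly"
  assumes Q: "ideal Q (poly_ring V)" and f: "vars f \<subseteq> V"
    and eq: "\<And>m m'. Poly_Mapping.keys m \<subseteq> V \<Longrightarrow> Poly_Mapping.keys m' \<subseteq> V \<Longrightarrow> cl m = cl m' \<Longrightarrow>
      Monom m - Monom m' \<in> Q"
    and bad: "\<And>m. Poly_Mapping.keys m \<subseteq> V \<Longrightarrow> B (cl m) \<Longrightarrow> Monom m \<in> Q"
    and zero: "\<And>c. \<not> B c \<Longrightarrow>
      (\<Sum>m\<in>{m \<in> Poly_Mapping.keys f. cl m = c}. Poly_Mapping.lookup f m) = 0"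
  shows "f \<in> Q"
proof -
  let ?K = "Poly_Mapping.keys f" and ?c = "Poly_Mapping.lookup f"
  \<comment> \<open>Representatives come from the support of \<open>f\<close>, which keeps their
    variables in \<open>V\<close>.\<close>
  define rep where "rep c = (SOME m. m \<in> ?K \<and> cl m = c)" for c
  have rep: "rep (cl m) \<in> ?K \<and> cl (rep (cl m)) = cl m" if "m \<in> ?K" for m
    unfolding rep_def by (rule someI[of _ m]) (use that in simp)
  have V: "Poly_Mapping.keys m \<subseteq> V" if "m \<in> ?K" for m
    using that f by (auto simp: vars_def)
  have "f = (\<Sum>m\<in>?K. Const (?c m) * Monom m)"
    by (subst poly_mapping_eq_sum_single) (simp add: single_eq_Const_mult)
  also have "\<dots> = (\<Sum>m\<in>?K. Const (?c m) * (Monom m - Monom (rep (cl m))))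
      + (\<Sum>m\<in>?K. Const (?c m) * Monom (rep (cl m)))"
    by (simp add: sum.distrib[symmetric] algebra_simps)
  also have "(\<Sum>m\<in>?K. Const (?c m) * Monom (rep (cl m)))
      = (\<Sum>c\<in>cl ` ?K. \<Sum>m\<in>{m \<in> ?K. cl m = c}. Const (?c m) * Monom (rep (cl m)))"
    by (rule sum.image_gen) simp
  also have "\<dots> = (\<Sum>c\<in>cl ` ?K. Const (\<Sum>m\<in>{m \<in> ?K. cl m = c}. ?c m) * Monom (rep c))"
    by (simp add: Const_sum sum_distrib_right)
  also have "(\<Sum>m\<in>?K. Const (?c m) * (Monom m - Monom (rep (cl m)))) + \<dots> \<in> Q"
  proof (intro ideal_add_closed[OF Q] ideal_sum_closed[OF Q])
    show "Const (?c m) * (Monom m - Monom (rep (cl m))) \<in> Q" if "m \<in> ?K" for m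
      using rep[OF that] V that by (intro ideal_mult_closed[OF Q] eq) auto
    show "Const (\<Sum>m\<in>{m \<in> ?K. cl m = c}. ?c m) * Monom (rep c) \<in> Q" if c: "c \<in> cl ` ?K" for c
    proof (cases "B c")
      case True
      then show ?thesis using rep V c by (intro ideal_mult_closed[OF Q] bad) auto
    next
      case False
      then show ?thesis using zero ideal_zero_closed[OF Q] by simp
    qed
  qed
  finally show ?thesis .
qed

section \<open>Homomorphisms out of a monoid algebra\<close>

text \<open>The universal property: a ring homomorphism on the coefficients and a homomorphism from
  the additive monoid of exponents to the multiplicative monoid of the target combine to a ring
  homomorphism \<open>lift\<close>.\<close>

locale monoid_algebra_hom =
  fixes C :: "'a::comm_ring_1 \<Rightarrow> 'b::comm_ring_1" and h :: "'m::comm_monoid_add \<Rightarrow> 'b"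
  assumes C_0: "C 0 = 0" and C_1: "C 1 = 1" and C_add: "C (a + b) = C a + C b"
    and C_mult: "C (a * b) = C a * C b"
    and h_0: "h 0 = 1" and h_add: "h (m + m') = h m * h m'"
begin

definition lift :: "('m \<Rightarrow>\<^sub>0 'a) \<Rightarrow> 'b"
  where "lift f = (\<Sum>m\<in>Poly_Mapping.keys f. C (Poly_Mapping.lookup f m) * h m)"

lemma lift_add: "lift (f + g) = lift f + lift g"
  unfolding lift_def
  \<comment> \<open>Keys outside a support contribute \<open>C 0 * h m = 0\<close>, so cancellation
    in \<open>f + g\<close> does no harm.\<close>
  by (rule setsum_keys_plus_distrib) (simp_all add: C_0 C_add algebra_simps)

lemma lift_0: "lift 0 = 0"
  by (simp add: lift_def)

lemma lift_single: "lift (Poly_Mapping.single m c) = C c * h m"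
  by (simp add: lift_def C_0)

lemma lift_1: "lift 1 = 1"
  using lift_single[of 0 1] by (simp add: C_1 h_0)

lemma lift_sum: "lift (sum f A) = (\<Sum>i\<in>A. lift (f i))"
  by (induction A rule: infinite_finite_induct) (simp_all add: lift_0 lift_add)

lemma lift_mult: "lift (f * g) = lift f * lift g"
proof -
  let ?c = Poly_Mapping.lookup
  have "f * g = (\<Sum>m\<in>Poly_Mapping.keys f. \<Sum>m'\<in>Poly_Mapping.keys g.
      Poly_Mapping.single (m + m') (?c f m * ?c g m'))"
    by (subst (1) poly_mapping_eq_sum_single[of f], subst (1) poly_mapping_eq_sum_single[of g])
      (simp add: sum_product mult_single)
  then have "lift (f * g) = (\<Sum>m\<in>Poly_Mapping.keys f. \<Sum>m'\<in>Poly_Mapping.keys g.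
      (C (?c f m) * h m) * (C (?c g m') * h m'))"
    by (simp add: lift_sum lift_single C_mult h_add ac_simps)
  then show ?thesis by (simp add: lift_def sum_product)
qed

lemma lift_diff: "lift (f - g) = lift f - lift g"
  using lift_add[of "f - g" g] by (simp add: algebra_simps)

lemma lift_power: "lift (f ^ n) = lift f ^ n"
  by (induction n) (simp_all add: lift_1 lift_mult)

end

section \<open>Powers of \<open>t\<close> in a polynomial ring over a domain\<close>

text \<open>The lowest nonzero coefficient of \<open>p\<close> reappears in \<open>p * q\<close>
  multiplied by \<open>coeff q 0\<close>, and over a domain this product is nonzero.\<close>

lemma monom_dvd_mult_cancel:
  fixes p q :: "'a::idom poly"
  assumes "monom 1 n dvd p * q" "coeff q 0 \<noteq> 0"
  shows "monom 1 n dvd p"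
proof -
  have "coeff p k = 0" if "k < n" for k
    using that
  proof (induction k rule: less_induct)
    case (less k)
    have "coeff (p * q) k = (\<Sum>i\<le>k. coeff p i * coeff q (k - i))"
      by (rule coeff_mult)
    also have "\<dots> = (\<Sum>i\<in>{k}. coeff p i * coeff q (k - i))"
      \<comment> \<open>The summands with \<open>i < k\<close> vanish by the induction
        hypothesis.\<close>
      by (rule sum.mono_neutral_right) (use less in auto)
    finally have "coeff (p * q) k = coeff p k * coeff q 0" by simp
    then show ?case using assms less(2) by (auto simp: monom_1_dvd_iff')
  qed
  then show ?thesis by (simp add: monom_1_dvd_iff')
qed

text \<open>Either \<open>q\<close> has nonzero constant coefficient and cancels, or
  \<open>t\<close> divides \<open>q\<close> and hence \<open>t^n\<close> divides
  \<open>q^n\<close>.\<close>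

lemma monom_dvd_mult_imp_power:
  fixes p q :: "'a::idom poly"
  assumes "monom 1 n dvd p * q"
  shows "monom 1 n dvd p \<or> monom 1 n dvd q ^ n"
proof (cases "coeff q 0 = 0")
  case True
  then have "monom 1 1 dvd q" by (simp add: monom_1_dvd_iff')
  then have "monom 1 1 ^ n dvd q ^ n" by (rule dvd_power_same)
  then show ?thesis by (simp add: monom_power)
next
  case False
  then show ?thesis using monom_dvd_mult_cancel[OF assms] by blast
qed

section \<open>Minors of a two-column matrix\<close>

lemma det_mat_2:
  assumes "A \<in> carrier_mat 2 2"
  shows "det A = A $$ (0,0) * A $$ (1,1) - A $$ (0,1) * A $$ (1,0)"
proof -
  have "det A = (\<Sum>i<2. A $$ (i,0) * cofactor A i 0)"
    using laplace_expansion_column[OF assms, of 0] by simp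
  also have "\<dots> = A $$ (0,0) * A $$ (1,1) - A $$ (0,1) * A $$ (1,0)"
    using assms by (simp add: numeral_2_eq_2 cofactor_def det_single mat_delete_def)
  finally show ?thesis .
qed

text \<open>\<open>submatrix\<close> numbers its rows and columns through \<open>pick\<close>, so
  this fixes their order and with it the sign of the minor.\<close>

lemma pick_pair:
  assumes "p < (q::nat)"
  shows "pick {p, q} 0 = p" "pick {p, q} (Suc 0) = q"
proof -
  show "pick {p, q} 0 = p" using assms by (auto intro!: Least_equality)
  have "{a \<in> {p,q}. a < q} = {p}" using assms by auto
  then show "pick {p, q} (Suc 0) = q" using pick_card_in_set[of q "{p,q}"] by simp
qed

lemma minor_two_cols:
  assumes "dim_col M = 2" "p < q" "q < dim_row M"
  shows "det (submatrix M {p, q} {0, 1}) = M $$ (p,0) * M $$ (q,1) - M $$ (p,1) * M $$ (q,0)"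
proof -
  have *: "{i. i < dim_row M \<and> i \<in> {p, q}} = {p, q}" "{j. j < dim_col M \<and> j \<in> {0, 1}} = {0, 1}"
    using assms by auto
  have S: "submatrix M {p, q} {0, 1} = mat 2 2 (\<lambda>(i, j). M $$ (pick {p, q} i, pick {0, 1} j))"
    using assms unfolding submatrix_def * by (simp add: numeral_2_eq_2)
  show ?thesis
    unfolding S using pick_pair[OF assms(2)] pick_pair[of 0 1] by (subst det_mat_2) auto
qed

lemma minors_two_cols:
  assumes "dim_col M = 2"
  shows "minors 2 M = {M $$ (p,0) * M $$ (q,1) - M $$ (p,1) * M $$ (q,0) | p q. p < q \<and> q < dim_row M}"
    (is "_ = ?R")
proof
  show "minors 2 M \<subseteq> ?R"
  proof
    fix d assume "d \<in> minors 2 M"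
    then obtain S T where d: "d = det (submatrix M S T)" and S: "S \<subseteq> {..<dim_row M}" "card S = 2"
      and T: "T \<subseteq> {..<2}" "card T = 2"
      using assms by (auto simp: minors_def)
    have "T = {..<2}" using T by (intro card_subset_eq) auto
    then have T: "T = {0, 1}" by auto
    obtain p q where "S = {p, q}" "p < q"
      using S(2) by (metis card_2_iff insert_commute nat_neq_iff)
    then show "d \<in> ?R" using minor_two_cols[OF assms] S d T by fastforce
  qed
  show "?R \<subseteq> minors 2 M"
  proof
    fix d assume "d \<in> ?R"
    then obtain p q where "p < q" "q < dim_row M"
      "d = M $$ (p,0) * M $$ (q,1) - M $$ (p,1) * M $$ (q,0)" by blast
    then show "d \<in> minors 2 M" unfolding minors_def
      using minor_two_cols[OF assms, of p q] assms
      by (intro CollectI exI[of _ "{p, q}"] exI[of _ "{0, 1}"]) auto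
  qed
qed

subsection \<open>The minors of the two-column matrix\<close>

text \<open>The entry of \<open>(J - lambda) x\<close> in the given row: the next variable of the
  same Jordan block, or 0 in the last row of the block.\<close>

definition nxt :: "(nat \<Rightarrow> nat) \<Rightarrow> index \<Rightarrow> (index, 'a::zero_neq_one) mvpoly"
  where "nxt r = (\<lambda>(i1, i2, i3). if i3 < r i1 then Var (i1, i2, Suc i3) else 0)"

lemma vec_of_list_append: "vec_of_list (xs @ ys) = vec_of_list xs @\<^sub>v vec_of_list ys"
  by (rule eq_vecI) (auto simp: vec_of_list_index nth_append)

lemma jordan_block_mult_vec:
  fixes X :: "nat \<Rightarrow> ('v, 'a::comm_ring_1) mvpoly"
  shows "map_mat Const (jordan_block n c) *\<^sub>v vec_of_list (map X [1..<Suc n]) =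
    vec_of_list (map (\<lambda>s. Const c * X s + (if s < n then X (Suc s) else 0)) [1..<Suc n])"
proof (rule eq_vecI)
  fix i assume "i < dim_vec (vec_of_list
    (map (\<lambda>s. Const c * X s + (if s < n then X (Suc s) else 0)) [1..<Suc n]))"
  then have i: "i < n" by (simp del: upt_Suc)
  \<comment> \<open>Matrix rows count from 0 and third indices from 1, so row \<open>i\<close>
    carries \<open>X (Suc i)\<close>.\<close>
  have "(map_mat Const (jordan_block n c) *\<^sub>v vec_of_list (map X [1..<Suc n])) $ i
      = (\<Sum>j<n. Const (if i = j then c else if Suc i = j then 1 else 0) * X (Suc j))"
    using i by (simp add: scalar_prod_def vec_of_list_index lessThan_atLeast0 del: upt_Suc)
  also have "\<dots> = (\<Sum>j<n. (if j = i then Const c * X (Suc i) else 0)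
      + (if j = Suc i then X (Suc (Suc i)) else 0))"
    by (rule sum.cong) auto
  also have "\<dots> = Const c * X (Suc i) + (if Suc i < n then X (Suc (Suc i)) else 0)"
    using i by (simp add: sum.distrib)
  finally show "(map_mat Const (jordan_block n c) *\<^sub>v vec_of_list (map X [1..<Suc n])) $ i =
    vec_of_list (map (\<lambda>s. Const c * X s + (if s < n then X (Suc s) else 0)) [1..<Suc n]) $ i"
    using i by (simp add: vec_of_list_index del: upt_Suc)
qed (simp del: upt_Suc)

text \<open>A block diagonal matrix acts on each block separately, so induction on the list of
  blocks reduces this to a single one. A block is listed as a pair of size class and copy number,
  which is what names its variables.\<close>

lemma jordan_matrix_mult_vec:
  fixes r :: "nat \<Rightarrow> nat" and c :: "'a::comm_ring_1"
  defines "L \<equiv> \<lambda>bs. concat (map (\<lambda>(a, b). map (\<lambda>s. (a, b, s)) [1..<Suc (r a)]) bs)"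
  shows "map_mat Const (jordan_matrix (map (\<lambda>(a, b). (r a, c)) bs)) *\<^sub>v vec_of_list (map Var (L bs)) =
    vec_of_list (map (\<lambda>u. Const c * Var u + nxt r u) (L bs))"
proof (induction bs)
  case Nil
  show ?case by (rule eq_vecI) (simp_all add: L_def jordan_matrix_def)
next
  case (Cons ab bs)
  obtain a b where ab: "ab = (a, b)" by fastforce
  let ?J = "jordan_matrix (map (\<lambda>(a, b). (r a, c)) bs)"
  let ?N = "sum_list (map fst (map (\<lambda>(a, b). (r a, c)) bs))"
  have len: "length (L bs) = ?N"
    by (simp add: L_def length_concat comp_def case_prod_unfold del: upt_Suc)
  have L: "L (ab # bs) = map (\<lambda>s. (a, b, s)) [1..<Suc (r a)] @ L bs"
    by (simp add: L_def ab)
  let ?x = "vec_of_list (map (\<lambda>s. Var (a, b, s)) [1..<Suc (r a)]) :: (index, 'a) mvpoly vec"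
  let ?y = "vec_of_list (map Var (L bs)) :: (index, 'a) mvpoly vec"
  have x: "vec_of_list (map Var (L (ab # bs))) = ?x @\<^sub>v ?y"
    unfolding L map_append vec_of_list_append map_map comp_def ..
  have map_zero: "map_mat Const (0\<^sub>m m n) = (0\<^sub>m m n :: (index, 'a) mvpoly mat)" for m n
    by (rule eq_matI) auto
  have J: "map_mat Const (jordan_matrix (map (\<lambda>(a, b). (r a, c)) (ab # bs)))
      = four_block_mat (map_mat Const (jordan_block (r a) c)) (0\<^sub>m (r a) ?N) (0\<^sub>m ?N (r a))
          (map_mat Const ?J :: (index, 'a) mvpoly mat)"
    unfolding ab list.map(2) prod.case jordan_matrix_Cons
    by (subst map_four_block_mat[of _ "r a" "r a" _ ?N _ ?N]) (simp_all only: map_zero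
      jordan_block_carrier jordan_matrix_carrier zero_carrier_mat)
  have "map_mat Const (jordan_matrix (map (\<lambda>(a, b). (r a, c)) (ab # bs))) *\<^sub>v vec_of_list (map Var (L (ab # bs)))
      = map_mat Const (jordan_block (r a) c) *\<^sub>v ?x @\<^sub>v map_mat Const ?J *\<^sub>v ?y"
    unfolding J x
    by (rule mult_mat_vec_split) (simp_all only: map_carrier_mat jordan_block_carrier
      jordan_matrix_carrier carrier_vec_def mem_Collect_eq dim_vec_of_list length_map length_upt len diff_Suc_1)
  also have "\<dots> = vec_of_list (map (\<lambda>s. Const c * Var (a, b, s) + (if s < r a then Var (a, b, Suc s) else 0)) [1..<Suc (r a)])
      @\<^sub>v vec_of_list (map (\<lambda>u. Const c * Var u + nxt r u) (L bs))"
    unfolding jordan_block_mult_vec Cons.IH ..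
  also have "\<dots> = vec_of_list (map (\<lambda>u. Const c * Var u + nxt r u) (L (ab # bs)))"
    unfolding L map_append vec_of_list_append map_map comp_def nxt_def prod.case ..
  finally show ?case .
qed

lemma Jx_x_index:
  assumes "p < length (Lambda_list l k r)"
  shows "Jx_x l k r c $$ (p, 0) = Const c * Var (Lambda_list l k r ! p) + nxt r (Lambda_list l k r ! p)"
    and "Jx_x l k r c $$ (p, 1) = Var (Lambda_list l k r ! p)"
proof -
  \<comment> \<open>The list of all blocks: replaced by their sizes they give the list in
    \<open>jordan_J\<close>, and expanded into their rows they give
    \<open>Lambda_list\<close>.\<close>
  let ?bs = "[(a, b). a \<leftarrow> [1..<Suc l], b \<leftarrow> [1..<Suc (k a)]]"
  have concat_map_concat: "concat (map f (concat xss)) = concat (map (\<lambda>xs. concat (map f xs)) xss)"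
    for f :: "nat \<times> nat \<Rightarrow> index list" and xss by (induction xss) auto
  have L: "concat (map (\<lambda>(a, b). map (\<lambda>s. (a, b, s)) [1..<Suc (r a)]) ?bs) = Lambda_list l k r"
    by (simp add: Lambda_list_def concat_map_concat comp_def del: upt_Suc)
  have "map (\<lambda>(a, b). (r a, c)) ?bs = concat (map (\<lambda>i. replicate (k i) (r i, c)) [1..<Suc l])"
    by (simp add: map_concat comp_def map_replicate_const del: upt_Suc)
  then have "map_mat Const (jordan_J l k r c) *\<^sub>v x_vec l k r =
      vec_of_list (map (\<lambda>u. Const c * Var u + nxt r u) (Lambda_list l k r))"
    using jordan_matrix_mult_vec[of r c ?bs] unfolding L jordan_J_def x_vec_def by simp
  then show "Jx_x l k r c $$ (p, 0) = Const c * Var (Lambda_list l k r ! p) + nxt r (Lambda_list l k r ! p)"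
    and "Jx_x l k r c $$ (p, 1) = Var (Lambda_list l k r ! p)"
    using assms by (simp_all add: Jx_x_def mat_of_cols_def x_vec_def vec_of_list_index)
qed

text \<open>The two products containing \<open>Const c\<close> cancel in each minor, which leaves
  \<open>nxt\<close>. A minor takes its rows in increasing order, so for arbitrary \<open>u\<close>
  and \<open>v\<close> the second part holds only up to sign.\<close>

lemma minors_Jx_x:
  fixes c :: "'a::field"
  shows "minors 2 (Jx_x l k r c) \<subseteq>
    {nxt r u * Var v - Var u * nxt r v | u v. u \<in> Lambda l k r \<and> v \<in> Lambda l k r}"
  and "u \<in> Lambda l k r \<Longrightarrow> v \<in> Lambda l k r \<Longrightarrow> u \<noteq> v \<Longrightarrow>
    nxt r u * Var v - Var u * nxt r v \<in> minors 2 (Jx_x l k r c)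
    \<or> - (nxt r u * Var v - Var u * nxt r v) \<in> minors 2 (Jx_x l k r c)"
proof -
  let ?L = "Lambda_list l k r"
  let ?M = "Jx_x l k r c"
  let ?D = "\<lambda>u v. nxt r u * Var v - Var u * nxt r v :: (index, 'a) mvpoly"
  have M: "dim_col ?M = 2" "dim_row ?M = length ?L"
    by (simp_all add: Jx_x_def x_vec_def)
  have D: "?M $$ (p,0) * ?M $$ (q,1) - ?M $$ (p,1) * ?M $$ (q,0) = ?D (?L ! p) (?L ! q)"
    if "p < length ?L" "q < length ?L" for p q
    unfolding Jx_x_index[OF that(1)] Jx_x_index[OF that(2)] by (simp add: algebra_simps)
  show "minors 2 ?M \<subseteq> {?D u v | u v. u \<in> Lambda l k r \<and> v \<in> Lambda l k r}"
  proof
    fix d assume "d \<in> minors 2 ?M"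
    then obtain p q where pq: "p < q" "q < length ?L"
      and d: "d = ?M $$ (p,0) * ?M $$ (q,1) - ?M $$ (p,1) * ?M $$ (q,0)"
      unfolding minors_two_cols[OF M(1)] M(2) by blast
    have "?L ! p \<in> Lambda l k r" "?L ! q \<in> Lambda l k r"
      using pq unfolding set_Lambda_list[symmetric] by auto
    then show "d \<in> {?D u v | u v. u \<in> Lambda l k r \<and> v \<in> Lambda l k r}"
      using D[of p q] pq d by (intro CollectI exI[of _ "?L ! p"] exI[of _ "?L ! q"]) simp
  qed
  have *: "?D (?L ! p) (?L ! q) \<in> minors 2 ?M" if "p < q" "q < length ?L" for p q
    unfolding minors_two_cols[OF M(1)] M(2)
    by (rule CollectI, rule exI[of _ p], rule exI[of _ q]) (use D[of p q] that in simp)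
  assume uv: "u \<in> Lambda l k r" "v \<in> Lambda l k r" "u \<noteq> v"
  then obtain p q where pq: "p < length ?L" "q < length ?L" "u = ?L ! p" "v = ?L ! q"
    unfolding set_Lambda_list[symmetric] in_set_conv_nth by auto
  have neg: "- ?D u v = ?D v u" by (simp add: algebra_simps)
  have "p < q \<or> q < p" using pq uv(3) by (cases p q rule: linorder_cases) auto
  then show "?D u v \<in> minors 2 ?M \<or> - ?D u v \<in> minors 2 ?M"
  proof
    assume "p < q"
    then show ?thesis using *[of p q] pq by simp
  next
    assume "q < p"
    then show ?thesis using *[of q p] pq unfolding neg by simp
  qed
qed

lemma vars_mult_subset:
  "vars p \<subseteq> V \<Longrightarrow> vars q \<subseteq> V \<Longrightarrow> vars (p * q :: ('v, 'a::comm_ring_1) mvpoly) \<subseteq> V"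
  using vars_mult[of p q] by blast

lemma vars_diff_subset:
  "vars p \<subseteq> V \<Longrightarrow> vars q \<subseteq> V \<Longrightarrow> vars (p - q :: ('v, 'a::comm_ring_1) mvpoly) \<subseteq> V"
  using vars_add[of p "- q"] by auto

subsection \<open>Multidegree, weight and the comparison map\<close>

definition head :: "index \<Rightarrow> index"
  where "head = (\<lambda>(i1, i2, i3). (i1, i2, 1))"

text \<open>The variable \<open>(i1, i2, 1)\<close> also plays the role of \<open>a(i1,i2)\<close>, so that multidegrees and
  monomials have the same type.\<close>

definition mdeg :: "(index \<Rightarrow>\<^sub>0 nat) \<Rightarrow> index \<Rightarrow>\<^sub>0 nat"
  where "mdeg m = (\<Sum>v\<in>Poly_Mapping.keys m. Poly_Mapping.single (head v) (Poly_Mapping.lookup m v))"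

definition weight :: "(index \<Rightarrow>\<^sub>0 nat) \<Rightarrow> nat"
  where "weight m = (\<Sum>v\<in>Poly_Mapping.keys m. Poly_Mapping.lookup m v * (snd (snd v) - 1))"

lemma fst_head [simp]: "fst (head v) = fst v"
  by (simp add: head_def case_prod_unfold)

lemma mdeg_0 [simp]: "mdeg 0 = 0"
  by (simp add: mdeg_def)

lemma weight_0 [simp]: "weight 0 = 0"
  by (simp add: weight_def)

lemma mdeg_add: "mdeg (m + m') = mdeg m + mdeg m'"
  unfolding mdeg_def by (rule setsum_keys_plus_distrib) (simp_all add: single_add)

lemma weight_add: "weight (m + m') = weight m + weight m'"
  unfolding weight_def
  by (rule setsum_keys_plus_distrib[where f = "\<lambda>v n. n * (snd (snd v) - 1)"]) (simp_all add: algebra_simps)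

lemma mdeg_single: "mdeg (Poly_Mapping.single v 1) = Poly_Mapping.single (head v) 1"
  by (simp add: mdeg_def)

lemma weight_single: "weight (Poly_Mapping.single v 1) = snd (snd v) - 1"
  by (simp add: weight_def)

text \<open>Natural exponents cannot cancel, so a block occurs in the multidegree exactly when one
  of its variables occurs in \<open>m\<close>.\<close>

lemma keys_mdeg: "Poly_Mapping.keys (mdeg m) = head ` Poly_Mapping.keys m"
proof -
  have "Poly_Mapping.keys (sum f A) = (\<Union>v\<in>A. Poly_Mapping.keys (f v))" if "finite A"
    for f :: "index \<Rightarrow> index \<Rightarrow>\<^sub>0 nat" and A
    using that by (induction A rule: finite_induct) (simp_all add: keys_nat_add)
  then show ?thesis by (auto simp: mdeg_def in_keys_iff)
qed

lemma mdeg_eq_0_iff: "mdeg m = 0 \<longleftrightarrow> m = 0"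
  using keys_mdeg[of m] keys_eq_empty[of m] keys_eq_empty[of "mdeg m"] by auto

lemma split_key:
  assumes "v \<in> Poly_Mapping.keys (m :: 'v \<Rightarrow>\<^sub>0 nat)"
  obtains n where "m = n + Poly_Mapping.single v 1"
proof -
  \<comment> \<open>The truncated subtraction is exact because \<open>v\<close> has exponent at
    least 1 in \<open>m\<close>.\<close>
  have "m = (m - Poly_Mapping.single v 1) + Poly_Mapping.single v 1"
    using assms by (intro poly_mapping_eqI) (auto simp: lookup_add lookup_minus lookup_single when_def in_keys_iff)
  then show thesis by (rule that)
qed

text \<open>The value of the comparison map on a monomial. The variable of the outer
  \<open>poly\<close> is \<open>t\<close>; the \<open>a(i1,i2)\<close> live in its
  coefficients.\<close>

definition hom_mon :: "nat \<Rightarrow> (index \<Rightarrow>\<^sub>0 nat) \<Rightarrow> (index, 'a::comm_ring_1) mvpoly poly"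
  where "hom_mon j m = (if \<forall>v\<in>Poly_Mapping.keys m. fst v \<le> j then monom (Monom (mdeg m)) (weight m) else 0)"

interpretation phi: monoid_algebra_hom "\<lambda>c. [:Const c:]"
  "hom_mon j :: _ \<Rightarrow> (index, 'a::comm_ring_1) mvpoly poly" for j
proof
  show "hom_mon j 0 = (1 :: (index, 'a) mvpoly poly)"
    by (simp add: hom_mon_def Monom_def)
  show "hom_mon j (m + m') = (hom_mon j m * hom_mon j m' :: (index, 'a) mvpoly poly)" for m m'
    by (auto simp: hom_mon_def keys_nat_add mdeg_add weight_add Monom_add mult_monom)
qed (simp_all add: Const_add Const_mult)

abbreviation phi :: "nat \<Rightarrow> (index, 'a::comm_ring_1) mvpoly \<Rightarrow> (index, 'a) mvpoly poly"
  where "phi \<equiv> phi.lift"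

lemma phi_Var: "phi j (Var v :: (index, 'a::comm_ring_1) mvpoly) =
    (if fst v \<le> j then monom (Var (head v)) (snd (snd v) - 1) else 0)"
  by (simp add: Var_def phi.lift_single hom_mon_def mdeg_single[simplified] weight_single[simplified] Monom_def)

text \<open>Each monomial that is not sent to zero goes to a single term with coefficient 1,
  determined by its multidegree and weight. The coefficient of that term in the image therefore
  collects exactly one class.\<close>

lemma lookup_coeff_phi:
  fixes f :: "(index, 'a::comm_ring_1) mvpoly"
  assumes "\<forall>v\<in>Poly_Mapping.keys a. fst v \<le> j"
  shows "Poly_Mapping.lookup (coeff (phi j f) w) a =
    (\<Sum>m\<in>{m \<in> Poly_Mapping.keys f. (mdeg m, weight m) = (a, w)}. Poly_Mapping.lookup f m)"
proof -
  have "Poly_Mapping.lookup (coeff ([:Const c:] * hom_mon j m) w) a =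
      (if (mdeg m, weight m) = (a, w) then c else 0)" for c :: 'a and m
  proof -
    \<comment> \<open>All monomials of multidegree \<open>a\<close> survive under
      \<open>hom_mon j\<close>, so none is missing from the sum.\<close>
    have "\<forall>v\<in>Poly_Mapping.keys m. fst v \<le> j" if "mdeg m = a"
      using assms unfolding that[symmetric] keys_mdeg by auto
    then show ?thesis
      by (auto simp: hom_mon_def coeff_monom single_eq_Const_mult[symmetric] lookup_single)
  qed
  then show ?thesis
    unfolding phi.lift_def coeff_sum lookup_sum by (simp only: sum.inter_filter[symmetric] finite_keys)
qed

section \<open>Preimages of powers of \<open>t\<close> and their primariness\<close>

lemma ideal_phi_dvd:
  fixes d :: "(index, 'a::comm_ring_1) mvpoly poly"
  shows "ideal {f. vars f \<subseteq> V \<and> d dvd phi j f} (poly_ring V)"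
proof -
  let ?R = "poly_ring V :: (index, 'a) mvpoly ring"
  interpret cring ?R by (rule cring_poly_ring)
  have neg: "\<ominus>\<^bsub>?R\<^esub> f = - f" if "vars f \<subseteq> V" for f
    using that by (intro minus_equality) auto
  have phi_neg: "phi j (- f) = - phi j f" for f :: "(index, 'a) mvpoly"
    using phi.lift_diff[of j 0 f] by (simp add: phi.lift_0)
  show ?thesis
  proof (rule idealI)
    show "ring ?R" by (rule ring_axioms)
    show "subgroup {f. vars f \<subseteq> V \<and> d dvd phi j f} (add_monoid ?R)"
    proof (rule add.subgroupI)
      have "0 \<in> {f. vars f \<subseteq> V \<and> d dvd phi j f}" by (simp add: phi.lift_0)
      then show "{f. vars f \<subseteq> V \<and> d dvd phi j f} \<noteq> {}" by blast
    qed (auto simp: neg phi_neg phi.lift_add dest: subsetD[OF vars_add])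
  qed (auto simp: phi.lift_mult dest: subsetD[OF vars_mult])
qed

text \<open>The kernel of \<open>phi j\<close> followed by reduction modulo \<open>t^(r j)\<close>.
  It is a description of \<open>q_ideal\<close> that does not mention the eigenvalue.\<close>

definition q_ker :: "nat \<Rightarrow> (nat \<Rightarrow> nat) \<Rightarrow> (nat \<Rightarrow> nat) \<Rightarrow> nat \<Rightarrow> (index, 'a::field) mvpoly set"
  where "q_ker l k r j = {f. vars f \<subseteq> Lambda l k r \<and> monom 1 (r j) dvd phi j f}"

lemma ideal_q_ker: "ideal (q_ker l k r j) (poly_ring (Lambda l k r))"
  unfolding q_ker_def by (rule ideal_phi_dvd)

text \<open>The lexicographic order on \<open>index\<close> is what makes the type of polynomials a domain.\<close>

lemma primary_q_ker:
  assumes "r j \<ge> 1"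
  shows "primary_ideal (q_ker l k r j :: (index, 'a::field) mvpoly set) (poly_ring (Lambda l k r))"
  unfolding primary_ideal_def
proof (intro conjI ballI impI ideal_q_ker)
  have "\<not> monom 1 (r j) dvd (1 :: (index, 'a) mvpoly poly)"
    using assms by (auto simp: monom_1_dvd_iff' intro!: exI[of _ 0])
  then have "1 \<notin> (q_ker l k r j :: (index, 'a) mvpoly set)"
    by (simp add: q_ker_def phi.lift_1)
  moreover have "1 \<in> carrier (poly_ring (Lambda l k r) :: (index, 'a) mvpoly ring)" by simp
  ultimately show "q_ker l k r j \<noteq> carrier (poly_ring (Lambda l k r) :: (index, 'a) mvpoly ring)"
    by metis
  fix f g :: "(index, 'a) mvpoly"
  assume f: "f \<in> carrier (poly_ring (Lambda l k r))" and g: "g \<in> carrier (poly_ring (Lambda l k r))"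
    and "f \<otimes>\<^bsub>poly_ring (Lambda l k r)\<^esub> g \<in> q_ker l k r j"
  then have "monom 1 (r j) dvd phi j f * phi j g"
    by (simp add: q_ker_def phi.lift_mult)
  \<comment> \<open>The exponent \<open>r j\<close> works for every \<open>g\<close>, and it is at
    least 1 by assumption.\<close>
  then have "monom 1 (r j) dvd phi j f \<or> monom 1 (r j) dvd phi j g ^ r j"
    by (rule monom_dvd_mult_imp_power)
  moreover have "vars (g ^ n) \<subseteq> Lambda l k r" for n
    using g by (induction n) (simp_all add: vars_mult_subset)
  ultimately have "f \<in> q_ker l k r j \<or> g [^]\<^bsub>poly_ring (Lambda l k r)\<^esub> r j \<in> q_ker l k r j"
    using f by (simp add: q_ker_def pow_poly_ring phi.lift_power)
  then show "f \<in> q_ker l k r j \<or> (\<exists>n::nat\<ge>1. g [^]\<^bsub>poly_ring (Lambda l k r)\<^esub> n \<in> q_ker l k r j)"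
    using assms by blast
qed


subsection \<open>Monomials modulo the ideal of minors\<close>

locale block_sizes =
  fixes l :: nat and k r :: "nat \<Rightarrow> nat"
  assumes l_pos: "l \<ge> 1"
    and r_pos: "\<And>i. i \<in> {1..l} \<Longrightarrow> r i \<ge> 1"
    and r_decreasing: "\<And>i j. i \<in> {1..l} \<Longrightarrow> j \<in> {1..l} \<Longrightarrow> i < j \<Longrightarrow> r i > r j"
begin

abbreviation "R \<equiv> poly_ring (Lambda l k r)"

lemma r_antimono: "i \<in> {1..l} \<Longrightarrow> j \<in> {1..l} \<Longrightarrow> i \<le> j \<Longrightarrow> r j \<le> r i"
  using r_decreasing[of i j] by (cases "i = j") auto

lemma vars_nxt: "u \<in> Lambda l k r \<Longrightarrow> vars (nxt r u :: (index, 'a::zero_neq_one) mvpoly) \<subseteq> Lambda l k r"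
  by (auto simp: nxt_def Lambda_def split: if_splits)

lemma minors_subset_carrier: "minors 2 (Jx_x l k r c) \<subseteq> carrier (R :: (index, 'a::field) mvpoly ring)"
proof
  fix d assume "d \<in> minors 2 (Jx_x l k r c)"
  then obtain u v where "d = nxt r u * Var v - Var u * nxt r v" "u \<in> Lambda l k r" "v \<in> Lambda l k r"
    using minors_Jx_x(1) by blast
  then show "d \<in> carrier R"
    by (simp add: vars_diff_subset vars_mult_subset vars_nxt)
qed

lemma ideal_I_lam: "ideal (I_lam l k r c) R"
proof -
  interpret cring R by (rule cring_poly_ring)
  show ?thesis unfolding I_lam_def by (rule genideal_ideal[OF minors_subset_carrier])
qed

lemma vars_subset_carrier:
  "Var ` (Lambda1 l k r j \<union> Lambda2 l k r j) \<subseteq> carrier (R :: (index, 'a::field) mvpoly ring)"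
  by (auto simp: Lambda1_def Lambda2_def)

lemma ideal_I_var: "ideal (I_var l k r j) R"
proof -
  interpret cring R by (rule cring_poly_ring)
  show ?thesis unfolding I_var_def by (rule genideal_ideal[OF vars_subset_carrier])
qed

text \<open>If \<open>i1 > j\<close> the index lies in \<open>Lambda2\<close> whatever
  \<open>i3\<close> is; otherwise \<open>i3 > r j\<close> puts it into
  \<open>Lambda1\<close>.\<close>

lemma Var_mem_I_var:
  assumes "(i1, i2, i3) \<in> Lambda l k r" "j \<in> {1..l}" "i1 > j \<or> i3 > r j"
  shows "Var (i1, i2, i3) \<in> I_var l k r j"
proof -
  interpret cring R by (rule cring_poly_ring)
  show ?thesis
    using genideal_self[OF vars_subset_carrier, of j] assms unfolding I_var_def
    by (auto simp: Lambda1_def Lambda2_def Lambda_def image_subset_iff)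
qed

lemma ideal_q_ideal: "ideal (q_ideal l k r c j) R"
proof -
  interpret cring R by (rule cring_poly_ring)
  show ?thesis unfolding q_ideal_def by (rule add_ideals[OF ideal_I_lam ideal_I_var])
qed

lemma I_lam_subset_q_ideal: "I_lam l k r c \<subseteq> q_ideal l k r c j"
  using ideal_zero_closed[OF ideal_I_var, of j] by (force simp: q_ideal_def set_add_def')

lemma I_var_subset_q_ideal: "I_var l k r j \<subseteq> q_ideal l k r c j"
  using ideal_zero_closed[OF ideal_I_lam, of c] by (force simp: q_ideal_def set_add_def')

text \<open>Up to \<open>t^(r_j)\<close>, the image of the generic column under \<open>phi\<close> is an eigenvector with
  eigenvalue \<open>t\<close>; this is why the minors vanish.\<close>

lemma monom_dvd_phi_nxt:
  assumes "u \<in> Lambda l k r" "j \<in> {1..l}"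
  shows "monom 1 (r j) dvd phi j (nxt r u) - monom 1 1 * phi j (Var u :: (index, 'a::field) mvpoly)"
proof -
  obtain i1 i2 i3 where u: "u = (i1, i2, i3)" by (metis prod_cases3)
  with assms have "i1 \<in> {1..l}" "i3 \<ge> 1" "i3 \<le> r i1" by (auto simp: Lambda_def)
  \<comment> \<open>If \<open>i1 \<le> j\<close>, the difference is zero except in the last row,
    where it is \<open>-a(i1,i2) t^(r i1)\<close>; this is divisible because
    \<open>r j \<le> r i1\<close>.\<close>
  moreover from this have "i1 \<le> j \<Longrightarrow> r j \<le> r i1" using r_antimono assms(2) by blast
  ultimately show ?thesis
    by (auto simp: u nxt_def phi_Var phi.lift_0 head_def mult_monom monom_1_dvd_iff' coeff_monom)
qed

lemma minor_mem_q_ker: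
  assumes "u \<in> Lambda l k r" "v \<in> Lambda l k r" "j \<in> {1..l}"
  shows "nxt r u * Var v - Var u * nxt r v \<in> (q_ker l k r j :: (index, 'a::field) mvpoly set)"
proof -
  let ?t = "monom 1 1 :: (index, 'a) mvpoly poly" and ?p = "phi j :: (index, 'a) mvpoly \<Rightarrow> _"
  \<comment> \<open>Subtracting \<open>t\<close> times the second column from the first leaves the
    minor unchanged and makes the first column divisible by \<open>t^(r j)\<close>.\<close>
  have "?p (nxt r u * Var v - Var u * nxt r v) =
      (?p (nxt r u) - ?t * ?p (Var u)) * ?p (Var v) - ?p (Var u) * (?p (nxt r v) - ?t * ?p (Var v))"
    by (simp only: phi.lift_diff phi.lift_mult ring_distribs mult_ac) (simp add: algebra_simps)
  moreover have "monom 1 (r j) dvd \<dots>"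
    by (rule dvd_diff[OF dvd_mult2[OF monom_dvd_phi_nxt[OF assms(1,3)]]
      dvd_mult[OF monom_dvd_phi_nxt[OF assms(2,3)]]])
  ultimately show ?thesis
    using assms by (simp add: q_ker_def vars_diff_subset vars_mult_subset vars_nxt)
qed

lemma q_ideal_subset_q_ker:
  assumes j: "j \<in> {1..l}"
  shows "q_ideal l k r c j \<subseteq> q_ker l k r j"
proof -
  interpret cring R by (rule cring_poly_ring)
  have "I_lam l k r c \<subseteq> q_ker l k r j"
    unfolding I_lam_def
  proof (rule genideal_minimal[OF ideal_q_ker])
    show "minors 2 (Jx_x l k r c) \<subseteq> q_ker l k r j"
      using minors_Jx_x(1)[of l k r c] minor_mem_q_ker[OF _ _ j] by blast
  qed
  moreover have "I_var l k r j \<subseteq> q_ker l k r j"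
    unfolding I_var_def
  proof (rule genideal_minimal[OF ideal_q_ker])
    \<comment> \<open>On \<open>Lambda1\<close> the exponent \<open>i3 - 1\<close> of
      \<open>t\<close> is at least \<open>r j\<close>; on \<open>Lambda2\<close> the image is
      0.\<close>
    show "Var ` (Lambda1 l k r j \<union> Lambda2 l k r j) \<subseteq> q_ker l k r j"
      by (auto simp: q_ker_def Lambda1_def Lambda2_def phi_Var monom_1_dvd_iff' coeff_monom)
  qed
  ultimately show ?thesis
    using ideal_add_closed[OF ideal_q_ker[of l k r j]] by (auto simp: q_ideal_def set_add_def')
qed

text \<open>The sum is one entry of the coefficient of \<open>t^w\<close> in \<open>phi j f\<close>,
  and that coefficient vanishes below \<open>t^(r j)\<close>.\<close>

lemma q_ker_class_sum:
  assumes "f \<in> q_ker l k r j" "w < r j" "\<forall>v\<in>Poly_Mapping.keys a. fst v \<le> j"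
  shows "(\<Sum>m\<in>{m \<in> Poly_Mapping.keys f. (mdeg m, weight m) = (a, w)}. Poly_Mapping.lookup f m) = 0"
  using assms lookup_coeff_phi[OF assms(3), of f w] by (simp add: q_ker_def monom_1_dvd_iff')

lemma minor_mem_I_lam:
  assumes "u \<in> Lambda l k r" "v \<in> Lambda l k r"
  shows "nxt r u * Var v - Var u * nxt r v \<in> I_lam l k r (c :: 'a::field)"
proof (cases "u = v")
  case True
  then show ?thesis using ideal_zero_closed[OF ideal_I_lam, of c] by (simp add: mult.commute)
next
  case False
  interpret cring R by (rule cring_poly_ring)
  have "minors 2 (Jx_x l k r c) \<subseteq> I_lam l k r c"
    unfolding I_lam_def by (rule genideal_self[OF minors_subset_carrier])
  then have "nxt r u * Var v - Var u * nxt r v \<in> I_lam l k r c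
    \<or> - (nxt r u * Var v - Var u * nxt r v) \<in> I_lam l k r c"
    using minors_Jx_x(2)[OF assms False, of c] by (meson subsetD)
  then show ?thesis
    using ideal_uminus_closed[OF ideal_I_lam, of "- (nxt r u * Var v - Var u * nxt r v)" c] by auto
qed

text \<open>A minor of rows \<open>u\<close> and \<open>v\<close> allows one unit of weight to move
  from a variable of \<open>n\<close> to the distinguished variable without changing the
  multidegree. Induction on the weight of \<open>n\<close> moves all of it there, unless the
  distinguished variable runs past the end of its block; then the monomial is zero modulo the
  ideal.\<close>

lemma collect_weight:
  fixes c :: "'a::field"
  assumes "Poly_Mapping.keys n \<subseteq> Lambda l k r" "(i1, i2, s) \<in> Lambda l k r"
  shows "if weight n + s \<le> r i1
    then Monom (n + Poly_Mapping.single (i1, i2, s) 1)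
      - Monom (mdeg n + Poly_Mapping.single (i1, i2, weight n + s) 1) \<in> I_lam l k r c
    else Monom (n + Poly_Mapping.single (i1, i2, s) 1) \<in> I_lam l k r c"
  using assms
proof (induction "weight n" arbitrary: n s)
  case 0
  \<comment> \<open>At weight 0 every variable of \<open>n\<close> is the first of its block, so
    \<open>n\<close> is its own multidegree.\<close>
  have "head v = v" if "v \<in> Poly_Mapping.keys n" for v
  proof -
    have "snd (snd v) - 1 = 0"
      using 0(1) that by (auto simp: weight_def in_keys_iff)
    moreover have "snd (snd v) \<ge> 1" using 0(2) that by (auto simp: Lambda_def)
    ultimately show ?thesis by (auto simp: head_def case_prod_unfold prod_eq_iff)
  qed
  then have "mdeg n = (\<Sum>v\<in>Poly_Mapping.keys n. Poly_Mapping.single v (Poly_Mapping.lookup n v))"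
    by (simp add: mdeg_def)
  then have "mdeg n = n" using poly_mapping_eq_sum_single[of n] by simp
  moreover have "s \<le> r i1" using 0(3) by (simp add: Lambda_def)
  ultimately show ?case
    using 0(1)[symmetric] ideal_zero_closed[OF ideal_I_lam, of c] by simp
next
  case (Suc w)
  let ?I = "I_lam l k r c"
  have "\<exists>u\<in>Poly_Mapping.keys n. snd (snd u) - 1 \<noteq> 0"
    by (rule ccontr) (use Suc(2) in \<open>simp add: weight_def\<close>)
  then obtain u where u: "u \<in> Poly_Mapping.keys n" "snd (snd u) - 1 \<noteq> 0" by blast
  \<comment> \<open>The third index of \<open>u\<close> is at least 2, so its predecessor
    \<open>Suc p\<close> is still a row of the block.\<close>
  obtain a b p where p: "u = (a, b, Suc (Suc p))"
    using u(2) by (cases u) (metis One_nat_def diff_is_0_eq' nat_le_linear not_less_eq_eq old.nat.exhaust snd_conv)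
  obtain n' where n: "n = n' + Poly_Mapping.single u 1" using split_key[OF u(1)] .
  let ?u = "(a, b, Suc p)" and ?v = "(i1, i2, s)"
  let ?n = "n' + Poly_Mapping.single ?u 1"
  have uL: "u \<in> Lambda l k r" using u(1) Suc(3) by blast
  then have uL': "?u \<in> Lambda l k r" "Suc p < r a" by (auto simp: p Lambda_def)
  have n': "Poly_Mapping.keys n' \<subseteq> Lambda l k r" using Suc(3) by (auto simp: n keys_nat_add)
  have mdeg: "mdeg ?n = mdeg n"
    unfolding n mdeg_add mdeg_single by (simp add: p head_def)
  have weight: "weight n = Suc (weight ?n)"
    unfolding n weight_add weight_single by (simp add: p)
  have "Monom n' * (nxt r ?u * Var ?v - Var ?u * nxt r ?v) \<in> ?I"
    using n' by (intro ideal_mult_closed[OF ideal_I_lam] minor_mem_I_lam uL'(1) Suc(4)) simp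
  \<comment> \<open>Here \<open>nxt r ?u\<close> is the variable \<open>u\<close> itself, so the
    minor trades \<open>u\<close> for its predecessor and \<open>?v\<close> for its
    successor.\<close>
  then have shift: "Monom (n + Poly_Mapping.single ?v 1) - Monom ?n * nxt r ?v \<in> ?I"
    using uL'(2) by (simp add: n p Monom_add Monom_single[simplified] nxt_def algebra_simps)
  show ?case
  proof (cases "s < r i1")
    case False
    \<comment> \<open>In the last row \<open>nxt r ?v\<close> is 0, so \<open>shift\<close> puts the
      monomial itself into the ideal.\<close>
    then have "\<not> weight n + s \<le> r i1" using weight by simp
    then show ?thesis using shift False by (simp add: nxt_def)
  next
    case True
    then have sL: "(i1, i2, Suc s) \<in> Lambda l k r" using Suc(4) by (auto simp: Lambda_def)
    have shift: "Monom (n + Poly_Mapping.single ?v 1) - Monom (?n + Poly_Mapping.single (i1, i2, Suc s) 1) \<in> ?I"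
      using shift True by (simp add: nxt_def Monom_add Monom_single[simplified])
    have "Poly_Mapping.keys ?n \<subseteq> Lambda l k r" using n' uL'(1) by (auto simp: keys_nat_add)
    moreover have "w = weight ?n" using weight Suc(2) by simp
    moreover have ws: "weight n + s = weight ?n + Suc s" using weight by simp
    ultimately have IH: "if weight n + s \<le> r i1
      then Monom (?n + Poly_Mapping.single (i1, i2, Suc s) 1)
        - Monom (mdeg n + Poly_Mapping.single (i1, i2, weight n + s) 1) \<in> ?I
      else Monom (?n + Poly_Mapping.single (i1, i2, Suc s) 1) \<in> ?I"
      using Suc(1)[OF _ _ sL, of ?n] unfolding mdeg ws by blast
    show ?thesis
    proof (cases "weight n + s \<le> r i1")
      case True
      then show ?thesis using ideal_add_closed[OF ideal_I_lam shift] IH by fastforce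
    next
      case False
      then show ?thesis using ideal_add_closed[OF ideal_I_lam shift] IH by fastforce
    qed
  qed
qed

text \<open>Equal multidegrees provide a variable of the same block in both monomials. Collecting
  all weight there leads to the same normal form, or to zero in both cases.\<close>

lemma Monom_eq_mod_I_lam:
  fixes c :: "'a::field"
  assumes m: "Poly_Mapping.keys m \<subseteq> Lambda l k r" and m': "Poly_Mapping.keys m' \<subseteq> Lambda l k r"
    and deg: "mdeg m = mdeg m'" and wt: "weight m = weight m'"
  shows "Monom m - Monom m' \<in> I_lam l k r c"
proof (cases "m = 0")
  case True
  then show ?thesis using deg mdeg_eq_0_iff[of m'] ideal_zero_closed[OF ideal_I_lam, of c] by simp
next
  case False
  then obtain v where v: "v \<in> Poly_Mapping.keys m" using keys_eq_empty[of m] by blast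
  obtain i1 i2 s where vs: "v = (i1, i2, s)" by (metis prod_cases3)
  have "head v \<in> Poly_Mapping.keys (mdeg m')" using v unfolding deg[symmetric] keys_mdeg by blast
  then obtain s' where v': "(i1, i2, s') \<in> Poly_Mapping.keys m'"
    unfolding keys_mdeg by (auto simp: head_def vs)
  obtain n where n: "m = n + Poly_Mapping.single (i1, i2, s) 1" using split_key[OF v[unfolded vs]] .
  obtain n' where n': "m' = n' + Poly_Mapping.single (i1, i2, s') 1" using split_key[OF v'] .
  have "mdeg n = mdeg n'"
    using deg unfolding n n' mdeg_add mdeg_single by (simp add: head_def)
  moreover have L: "(i1, i2, s) \<in> Lambda l k r" "(i1, i2, s') \<in> Lambda l k r"
    "Poly_Mapping.keys n \<subseteq> Lambda l k r" "Poly_Mapping.keys n' \<subseteq> Lambda l k r"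
    using v v' m m' by (auto simp: vs n n' keys_nat_add)
  moreover have "weight n + s = weight n' + s'"
    using wt L(1,2) unfolding n n' weight_add weight_single by (auto simp: Lambda_def)
  ultimately show ?thesis
    using collect_weight[OF L(3,1), of c] collect_weight[OF L(4,2), of c]
      ideal_diff_closed[OF ideal_I_lam, of _ c] unfolding n n'
    by (fastforce split: if_splits)
qed

text \<open>Any variable of \<open>m\<close> may be chosen to collect the weight. Third indices
  start at 1, so the collecting variable ends at \<open>Suc (weight m)\<close>.\<close>

lemma Monom_collect_weight:
  fixes c :: "'a::field"
  assumes m: "Poly_Mapping.keys m \<subseteq> Lambda l k r" and v: "(i1, i2, s) \<in> Poly_Mapping.keys m"
  shows "weight m \<ge> r i1 \<Longrightarrow> Monom m \<in> I_lam l k r c"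
    and "weight m < r i1 \<Longrightarrow> \<exists>n. Poly_Mapping.keys n \<subseteq> Lambda l k r \<and>
      Monom m - Monom n * Var (i1, i2, Suc (weight m)) \<in> I_lam l k r c"
proof -
  obtain n where n: "m = n + Poly_Mapping.single (i1, i2, s) 1" using split_key[OF v] .
  have L: "Poly_Mapping.keys n \<subseteq> Lambda l k r" "(i1, i2, s) \<in> Lambda l k r"
    using v m by (auto simp: n keys_nat_add)
  have w: "weight n + s = Suc (weight m)"
    using L(2) unfolding n weight_add weight_single by (auto simp: Lambda_def)
  note * = collect_weight[OF L, of c, unfolded w, folded n]
  show "weight m \<ge> r i1 \<Longrightarrow> Monom m \<in> I_lam l k r c" using * by simp
  assume "weight m < r i1"
  then have "Monom m - Monom (mdeg n) * Var (i1, i2, Suc (weight m)) \<in> I_lam l k r c"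
    using * by (simp add: Monom_add Monom_single[simplified])
  \<comment> \<open>First rows of blocks that occur in \<open>n\<close> are again indices in
    \<open>Lambda\<close>.\<close>
  moreover have "Poly_Mapping.keys (mdeg n) \<subseteq> Lambda l k r"
    using L(1) by (force simp: keys_mdeg head_def Lambda_def)
  ultimately show "\<exists>n. Poly_Mapping.keys n \<subseteq> Lambda l k r \<and>
      Monom m - Monom n * Var (i1, i2, Suc (weight m)) \<in> I_lam l k r c" by blast
qed

section \<open>Identification of the components and their intersection\<close>

text \<open>For the harder inclusion, classes with all \<open>i1 \<le> j\<close> and weight below
  \<open>r j\<close> have coefficient sum zero by \<open>q_ker_class_sum\<close>. The monomials of
  all other classes are shown to lie in \<open>q_ideal\<close>.\<close>

lemma q_ideal_eq_q_ker:
  fixes c :: "'a::field"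
  assumes j: "j \<in> {1..l}"
  shows "q_ideal l k r c j = q_ker l k r j"
proof
  show "q_ideal l k r c j \<subseteq> q_ker l k r j" by (rule q_ideal_subset_q_ker[OF j])
  show "q_ker l k r j \<subseteq> q_ideal l k r c j"
  proof
    fix f :: "(index, 'a) mvpoly"
    assume f: "f \<in> q_ker l k r j"
    show "f \<in> q_ideal l k r c j"
    proof (rule mem_ideal_if_class_sums_zero[where cl = "\<lambda>m. (mdeg m, weight m)" and
          B = "\<lambda>(a, w). \<not> ((\<forall>v\<in>Poly_Mapping.keys a. fst v \<le> j) \<and> w < r j)"])
      show "ideal (q_ideal l k r c j) R" by (rule ideal_q_ideal)
      show "vars f \<subseteq> Lambda l k r" using f by (simp add: q_ker_def)
      show "Monom m - Monom m' \<in> q_ideal l k r c j"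
        if "Poly_Mapping.keys m \<subseteq> Lambda l k r" "Poly_Mapping.keys m' \<subseteq> Lambda l k r"
          "(mdeg m, weight m) = (mdeg m', weight m')" for m m'
        using Monom_eq_mod_I_lam[OF that(1,2), of c] that(3) I_lam_subset_q_ideal by auto
      show "(\<Sum>m\<in>{m \<in> Poly_Mapping.keys f. (mdeg m, weight m) = d}. Poly_Mapping.lookup f m) = 0"
        if "\<not> (\<lambda>(a, w). \<not> ((\<forall>v\<in>Poly_Mapping.keys a. fst v \<le> j) \<and> w < r j)) d" for d
        using that q_ker_class_sum[OF f, of "snd d" "fst d"] by (simp add: case_prod_unfold)
    next
      fix m assume m: "Poly_Mapping.keys m \<subseteq> Lambda l k r"
        and "(\<lambda>(a, w). \<not> ((\<forall>v\<in>Poly_Mapping.keys a. fst v \<le> j) \<and> w < r j)) (mdeg m, weight m)"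
      then have "(\<exists>v\<in>Poly_Mapping.keys m. fst v > j) \<or> weight m \<ge> r j"
        by (auto simp: keys_mdeg not_le)
      then show "Monom m \<in> q_ideal l k r c j"
      proof
        assume "\<exists>v\<in>Poly_Mapping.keys m. fst v > j"
        then obtain v where v: "v \<in> Poly_Mapping.keys m" "fst v > j" by blast
        obtain n where n: "m = n + Poly_Mapping.single v 1" using split_key[OF v(1)] .
        have "Var v \<in> I_var l k r j"
          using Var_mem_I_var[of "fst v" "fst (snd v)" "snd (snd v)" j] v m j by auto
        then have "Monom n * Var v \<in> I_var l k r j"
          using m by (intro ideal_mult_closed[OF ideal_I_var]) (auto simp: n keys_nat_add)
        then show ?thesis
          using I_var_subset_q_ideal by (auto simp: n Monom_add Monom_single[simplified])
      next
        assume w: "weight m \<ge> r j"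
        \<comment> \<open>Since \<open>r j \<ge> 1\<close>, the weight is positive and there is a
          variable to collect it.\<close>
        then have "m \<noteq> 0" using r_pos[OF j] by auto
        then obtain v where v: "v \<in> Poly_Mapping.keys m" using keys_eq_empty[of m] by blast
        obtain i1 i2 s where vs: "v = (i1, i2, s)" by (metis prod_cases3)
        show ?thesis
        \<comment> \<open>Either the weight overflows block \<open>i1\<close>, or the collecting
          variable exists; its third index then exceeds \<open>r j\<close>, so it lies in
          \<open>I_var\<close>.\<close>
        proof (cases "weight m \<ge> r i1")
          case True
          then show ?thesis
            using Monom_collect_weight(1)[OF m v[unfolded vs]] I_lam_subset_q_ideal by blast
        next
          case False
          then obtain n where n: "Poly_Mapping.keys n \<subseteq> Lambda l k r"
            "Monom m - Monom n * Var (i1, i2, Suc (weight m)) \<in> I_lam l k r c"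
            using Monom_collect_weight(2)[OF m v[unfolded vs]] by fastforce
          have "(i1, i2, Suc (weight m)) \<in> Lambda l k r"
            using m v False by (auto simp: vs Lambda_def)
          then have "Var (i1, i2, Suc (weight m)) \<in> I_var l k r j"
            using w by (intro Var_mem_I_var[OF _ j]) auto
          then have "Monom n * Var (i1, i2, Suc (weight m)) \<in> I_var l k r j"
            using n(1) by (intro ideal_mult_closed[OF ideal_I_var]) simp_all
          then have "Monom n * Var (i1, i2, Suc (weight m)) \<in> q_ideal l k r c j"
            by (rule subsetD[OF I_var_subset_q_ideal])
          from ideal_add_closed[OF ideal_q_ideal subsetD[OF I_lam_subset_q_ideal n(2)] this]
          show ?thesis by simp
        qed
      qed
    qed
  qed
qed

text \<open>A class that is good for some \<open>j\<close> has coefficient sum zero because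
  \<open>f\<close> lies in that \<open>q_ker\<close>. It remains to show that monomials whose class
  is good for no \<open>j\<close> already lie in \<open>I_lam\<close>.\<close>

lemma I_lam_eq_Inter:
  fixes c :: "'a::field"
  shows "I_lam l k r c = (\<Inter>j\<in>{1..l}. q_ideal l k r c j)"
proof
  show "I_lam l k r c \<subseteq> (\<Inter>j\<in>{1..l}. q_ideal l k r c j)"
    using I_lam_subset_q_ideal by blast
  show "(\<Inter>j\<in>{1..l}. q_ideal l k r c j) \<subseteq> I_lam l k r c"
  proof
    fix f assume "f \<in> (\<Inter>j\<in>{1..l}. q_ideal l k r c j)"
    then have f: "f \<in> q_ker l k r j" if "j \<in> {1..l}" for j
      using q_ideal_eq_q_ker[OF that, of c] that by blast
    let ?good = "\<lambda>(a, w) j. (\<forall>v\<in>Poly_Mapping.keys a. fst v \<le> j) \<and> w < r j"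
    show "f \<in> I_lam l k r c"
    proof (rule mem_ideal_if_class_sums_zero[where cl = "\<lambda>m. (mdeg m, weight m)" and
          B = "\<lambda>d. \<not> (\<exists>j\<in>{1..l}. ?good d j)"])
      show "ideal (I_lam l k r c) R" by (rule ideal_I_lam)
      show "vars f \<subseteq> Lambda l k r" using f[of 1] l_pos by (simp add: q_ker_def)
      show "Monom m - Monom m' \<in> I_lam l k r c"
        if "Poly_Mapping.keys m \<subseteq> Lambda l k r" "Poly_Mapping.keys m' \<subseteq> Lambda l k r"
          "(mdeg m, weight m) = (mdeg m', weight m')" for m m'
        using Monom_eq_mod_I_lam[OF that(1,2), of c] that(3) by auto
      show "(\<Sum>m\<in>{m \<in> Poly_Mapping.keys f. (mdeg m, weight m) = d}. Poly_Mapping.lookup f m) = 0"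
        if d: "\<not> \<not> (\<exists>j\<in>{1..l}. ?good d j)" for d
      proof -
        obtain j where "j \<in> {1..l}" "?good d j" using d by blast
        then show ?thesis
          using q_ker_class_sum[OF f, of j "snd d" "fst d"] by (simp add: case_prod_unfold)
      qed
    next
      fix m assume m: "Poly_Mapping.keys m \<subseteq> Lambda l k r"
        and bad: "\<not> (\<exists>j\<in>{1..l}. ?good (mdeg m, weight m) j)"
      show "Monom m \<in> I_lam l k r c"
      proof (cases "m = 0")
        case True
        \<comment> \<open>The class of the monomial 1 is good for \<open>j = 1\<close>, so this case
          contradicts \<open>bad\<close>.\<close>
        then show ?thesis using bad l_pos r_pos[of 1] by force
      next
        case False
        \<comment> \<open>All blocks of \<open>m\<close> have first index at most this
          \<open>j\<close>, so only the weight can make the class bad. It is then at least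
          \<open>r j\<close> and overflows a block of size \<open>r j\<close> that occurs in
          \<open>m\<close>.\<close>
        define j where "j = Max (fst ` Poly_Mapping.keys m)"
        have "j \<in> fst ` Poly_Mapping.keys m"
          unfolding j_def using False keys_eq_empty[of m] by (intro Max_in) auto
        then obtain i2 s where v: "(j, i2, s) \<in> Poly_Mapping.keys m" by force
        have "\<forall>v\<in>Poly_Mapping.keys (mdeg m). fst v \<le> j"
          by (auto simp: keys_mdeg j_def)
        moreover have "j \<in> {1..l}" using v m by (auto simp: Lambda_def)
        ultimately have "weight m \<ge> r j" using bad by (auto simp: not_less)
        then show ?thesis by (rule Monom_collect_weight(1)[OF m v])
      qed
    qed
  qed
qed

end

theorem theorem3p20:
  fixes lam :: "'a::field" and l :: nat and k r :: "nat \<Rightarrow> nat"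
  assumes "l \<ge> 1"
    and "\<And>i. i \<in> {1..l} \<Longrightarrow> k i \<ge> 1"
    and "\<And>i. i \<in> {1..l} \<Longrightarrow> r i \<ge> 1"
    and "\<And>i j. i \<in> {1..l} \<Longrightarrow> j \<in> {1..l} \<Longrightarrow> i < j \<Longrightarrow> r i > r j"
  shows "(\<forall>j\<in>{1..l}. primary_ideal (q_ideal l k r lam j) (poly_ring (Lambda l k r)))
    \<and> primary_decomposition (poly_ring (Lambda l k r)) (I_lam l k r lam) {1..l} (q_ideal l k r lam)"
proof -
  interpret block_sizes l k r
    by unfold_locales (use assms in auto)
  have "primary_ideal (q_ideal l k r lam j) R" if "j \<in> {1..l}" for j
    unfolding q_ideal_eq_q_ker[OF that] by (rule primary_q_ker[where r = r, OF r_pos[OF that]])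
  then show ?thesis
    using l_pos I_lam_eq_Inter[of lam] by (auto simp: primary_decomposition_def)
qed

end
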